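(* Let $\mathcal{T}=(t_{ijkl})$ be a real 4th-order 3-dimensional cyclic symmetric tensor. Suppose $\mathcal{T}$ is positive semi-definite, $|t_{1112}|=|t_{1222}|=t_{1122}=t_{1111}=1$ and $t_{1112}t_{1222}=-1$. Then $t_{1123}\ge -\frac{7}{12}$.
   Context: A 4th-order 3-dimensional real tensor $\mathcal{T}=(t_{ijkl})_{1\le i,j,k,l\le 3}$ is symmetric if its entries are invariant under all permutations of the indices. It is cyclic symmetric if it is symmetric and $t_{1111}=t_{2222}=t_{3333}$, $t_{1112}=t_{2223}=t_{1333}$, $t_{1113}=t_{1222}=t_{2333}$, $t_{1122}=t_{1133}=t_{2233}$, $t_{1123}=t_{1223}=t_{1233}$. For $x\in\mathbb{R}^3$, $\mathcal{T}x^4=\sum_{i,j,k,l=1}^3 t_{ijkl}x_ix_jx_kx_l$. $\mathcal{T}$ is positive semi-definite if $\mathcal{T}x^4\ge 0$ for all $x\in\mathbb{R}^3$. *)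

theory Defs
  imports "HOL-Analysis.Analysis"
begin

text \<open>
  The index set is the three-element numeral type \<^typ>\<open>3\<close>; its elements are written
  1, 2, 3, as for the components of \<^typ>\<open>real^3\<close> (in this type \<open>3 = 0\<close>).
\<close>

type_synonym tensor43 = "3 \<Rightarrow> 3 \<Rightarrow> 3 \<Rightarrow> 3 \<Rightarrow> real"

text \<open>
  The four index positions are the elements 1, 2, 3, 4 of \<^typ>\<open>4\<close>: \<open>i\<close> is an
  index tuple and \<open>p\<close> a permutation of its positions.
\<close>

definition symmetric_tensor :: "tensor43 \<Rightarrow> bool" where
  "symmetric_tensor t \<longleftrightarrow>
     (\<forall>(i :: 4 \<Rightarrow> 3) (p :: 4 \<Rightarrow> 4). bij p \<longrightarrow>
        t (i (p 1)) (i (p 2)) (i (p 3)) (i (p 4)) = t (i 1) (i 2) (i 3) (i 4))"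

definition cyclic_symmetric_tensor :: "tensor43 \<Rightarrow> bool" where
  "cyclic_symmetric_tensor t \<longleftrightarrow> symmetric_tensor t \<and>
     t 1 1 1 1 = t 2 2 2 2 \<and> t 2 2 2 2 = t 3 3 3 3 \<and>
     t 1 1 1 2 = t 2 2 2 3 \<and> t 2 2 2 3 = t 1 3 3 3 \<and>
     t 1 1 1 3 = t 1 2 2 2 \<and> t 1 2 2 2 = t 2 3 3 3 \<and>
     t 1 1 2 2 = t 1 1 3 3 \<and> t 1 1 3 3 = t 2 2 3 3 \<and>
     t 1 1 2 3 = t 1 2 2 3 \<and> t 1 2 2 3 = t 1 2 3 3"

definition tensor_form :: "tensor43 \<Rightarrow> real^3 \<Rightarrow> real" where
  "tensor_form t x =
     (\<Sum>i\<in>UNIV. \<Sum>j\<in>UNIV. \<Sum>k\<in>UNIV. \<Sum>l\<in>UNIV. t i j k l * x $ i * x $ j * x $ k * x $ l)"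

definition psd_tensor :: "tensor43 \<Rightarrow> bool" where
  "psd_tensor t \<longleftrightarrow> (\<forall>x. tensor_form t x \<ge> 0)"

end

theory Submission
  imports Defs
begin

text \<open>
  The bound is positive semi-definiteness tested at the single vector \<open>(1, 1, 1)\<close>, where the
  form is the sum of all 81 entries. Symmetry groups the entries by the multiset of their indices:
  3 entries of type \<open>iiii\<close>, \<open>4 \<cdot> 3\<close> equal to \<open>t 1 1 1 2\<close>, \<open>4 \<cdot> 3\<close> equal to \<open>t 1 2 2 2\<close>,
  \<open>6 \<cdot> 3\<close> of type \<open>iijj\<close> and \<open>12 \<cdot> 3\<close> of type \<open>iijk\<close> (\<open>tensor_form_ones\<close>). Two numbers of absolute value 1 with
  product \<open>-1\<close> are opposite, so the two middle groups cancel and what remains is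
  \<open>3 + 18 + 36 * t 1 1 2 3 \<ge> 0\<close>.
\<close>

text \<open>
  Adjacent transpositions generate all permutations of the four positions, so these three
  equations carry the whole symmetry, in a form suited to ordered rewriting.
\<close>

lemma symmetric_tensor_swap_adjacent:
  assumes "symmetric_tensor t"
  shows "t a b c d = t b a c d"
    and "t a b c d = t a c b d"
    and "t a b c d = t a b d c"
proof -
  define i :: "4 \<Rightarrow> 3" where
    "i = (\<lambda>q. if q = 1 then a else if q = 2 then b else if q = 3 then c else d)"
  have perm: "t (i (p 1)) (i (p 2)) (i (p 3)) (i (p 4)) = t (i 1) (i 2) (i 3) (i 4)"
    if "bij p" for p :: "4 \<Rightarrow> 4"
    using assms that unfolding symmetric_tensor_def by blast
  show "t a b c d = t b a c d"
    using perm[of "Transposition.transpose 1 2"] by (simp add: i_def transpose_def)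
  show "t a b c d = t a c b d"
    using perm[of "Transposition.transpose 2 3"] by (simp add: i_def transpose_def)
  show "t a b c d = t a b d c"
    using perm[of "Transposition.transpose 3 4"] by (simp add: i_def transpose_def)
qed

lemma tensor_form_ones:
  assumes "cyclic_symmetric_tensor t"
  shows "tensor_form t 1 =
    3 * t 1 1 1 1 + 12 * t 1 1 1 2 + 12 * t 1 2 2 2 + 18 * t 1 1 2 2 + 36 * t 1 1 2 3"
proof -
  have sym: "symmetric_tensor t"
    using assms by (simp add: cyclic_symmetric_tensor_def)
  note swaps = symmetric_tensor_swap_adjacent[OF sym]
  have entries: "t 2 2 2 2 = t 1 1 1 1" "t 3 3 3 3 = t 1 1 1 1"
    "t 2 2 2 3 = t 1 1 1 2" "t 1 3 3 3 = t 1 1 1 2"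
    "t 1 1 1 3 = t 1 2 2 2" "t 2 3 3 3 = t 1 2 2 2"
    "t 1 1 3 3 = t 1 1 2 2" "t 2 2 3 3 = t 1 1 2 2"
    "t 1 2 2 3 = t 1 1 2 3" "t 1 2 3 3 = t 1 1 2 3"
    using assms by (simp_all add: cyclic_symmetric_tensor_def)
  have "tensor_form t 1 = (\<Sum>i\<in>UNIV. \<Sum>j\<in>UNIV. \<Sum>k\<in>UNIV. \<Sum>l\<in>UNIV. t i j k l)"
    by (simp add: tensor_form_def)
  then show ?thesis
    by (simp add: sum_3 swaps entries)
qed

theorem theorem4p2:
  fixes t :: tensor43
  assumes "cyclic_symmetric_tensor t"
    and "psd_tensor t"
    and "\<bar>t 1 1 1 2\<bar> = 1" and "\<bar>t 1 2 2 2\<bar> = 1"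
    and "t 1 1 2 2 = 1" and "t 1 1 1 1 = 1"
    and "t 1 1 1 2 * t 1 2 2 2 = -1"
  shows "t 1 1 2 3 \<ge> - 7 / 12"
proof -
  have "t 1 1 1 2 + t 1 2 2 2 = 0"
    using assms(3,4,7) by (auto simp: abs_if split: if_splits)
  moreover have "tensor_form t 1 \<ge> 0"
    using assms(2) by (simp add: psd_tensor_def)
  ultimately show ?thesis
    using tensor_form_ones[OF assms(1)] assms(5,6) by simp
qed

end
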